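(* Let $(K,d)$ be a compact geodesic space satisfying the betweenness property, and let $\varepsilon>0$. Then for each $\varepsilon$-simple-pursuit curve $\zeta(\cdot)=\bigl(L(\cdot),M(\cdot)\bigr)\colon \mathbb{R}_+\to K^2$ there exists a number $T>0$ such that $d\bigl(L(T),M(T)\bigr)<\varepsilon$.
   Context: Let $(K,d)$ be a metric space and $\mathbb{R}_+=[0,+\infty)$. A geodesic path joining $A\in K$ to $B\in K$ is a map $\gamma\colon[a,b]\subset\mathbb{R}\to K$ with $\gamma(a)=A$, $\gamma(b)=B$ and $d(\gamma(t),\gamma(t'))=|t-t'|$ for all $t,t'\in[a,b]$. $(K,d)$ is a geodesic space if every pair of points of $K$ can be joined by a geodesic path (not necessarily unique). A point $C$ lies between $A$ and $B$ if $d(A,B)=d(A,C)+d(C,B)$. A geodesic space $(K,d)$ satisfies the betweenness property if for every four pairwise distinct points $A,B,C,D\in K$: whenever $B$ lies between $A$ and $C$, and $C$ lies between $B$ and $D$, then both $B$ and $C$ lie between $A$ and $D$. A curve $\zeta(\cdot)=\bigl(L(\cdot),M(\cdot)\bigr)$ from $\mathbb{R}_+$ to $K^2$, where $L(\cdot)$ and $M(\cdot)$ are 1-Lipschitz continuous, is called an $\varepsilon$-simple-pursuit curve if for each $i\in\mathbb{N}\cup\{0\}$ the condition $d\bigl(L(i\varepsilon),M(i\varepsilon)\bigr)\ge\varepsilon$ implies that $d\bigl(L(i\varepsilon),L((i+1)\varepsilon)\bigr)=\varepsilon$ and that $L\bigl((i+1)\varepsilon\bigr)$ lies between $L(i\varepsilon)$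 and $M(i\varepsilon)$. *)

theory Defs
  imports "HOL-Analysis.Analysis"
begin

text \<open>
  A metric space is a carrier set K together with a distance function d, as in the
  library locale \<^locale>\<open>Metric_space\<close>.
\<close>

definition geodesic_path ::
  "'a set \<Rightarrow> ('a \<Rightarrow> 'a \<Rightarrow> real) \<Rightarrow> (real \<Rightarrow> 'a) \<Rightarrow> real \<Rightarrow> real \<Rightarrow> 'a \<Rightarrow> 'a \<Rightarrow> bool"
  where "geodesic_path K d \<gamma> a b A B \<longleftrightarrow>
    a \<le> b \<and> \<gamma> \<in> {a..b} \<rightarrow> K \<and> \<gamma> a = A \<and> \<gamma> b = B \<and>
    (\<forall>t\<in>{a..b}. \<forall>t'\<in>{a..b}. d (\<gamma> t) (\<gamma> t') = \<bar>t - t'\<bar>)"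

definition geodesic_space :: "'a set \<Rightarrow> ('a \<Rightarrow> 'a \<Rightarrow> real) \<Rightarrow> bool"
  where "geodesic_space K d \<longleftrightarrow>
    Metric_space K d \<and> (\<forall>A\<in>K. \<forall>B\<in>K. \<exists>\<gamma> a b. geodesic_path K d \<gamma> a b A B)"

text \<open>The middle point is the first of the three point arguments.\<close>

definition lies_between :: "('a \<Rightarrow> 'a \<Rightarrow> real) \<Rightarrow> 'a \<Rightarrow> 'a \<Rightarrow> 'a \<Rightarrow> bool"
  where "lies_between d C A B \<longleftrightarrow> d A B = d A C + d C B"

definition betweenness_property :: "'a set \<Rightarrow> ('a \<Rightarrow> 'a \<Rightarrow> real) \<Rightarrow> bool"
  where "betweenness_property K d \<longleftrightarrow>
    (\<forall>A\<in>K. \<forall>B\<in>K. \<forall>C\<in>K. \<forall>D\<in>K.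
      distinct [A, B, C, D] \<and> lies_between d B A C \<and> lies_between d C B D \<longrightarrow>
      lies_between d B A D \<and> lies_between d C A D)"

text \<open>
  A map from the nonnegative reals to K is a function on all reals of which only the values
  on \<open>{0..}\<close> matter. The library predicate \<^const>\<open>lipschitz_on\<close> is tied to the type class
  of metric spaces, so the condition is spelled out for the explicit distance d.
\<close>

definition one_lipschitz_curve :: "'a set \<Rightarrow> ('a \<Rightarrow> 'a \<Rightarrow> real) \<Rightarrow> (real \<Rightarrow> 'a) \<Rightarrow> bool"
  where "one_lipschitz_curve K d f \<longleftrightarrow>
    f \<in> {0..} \<rightarrow> K \<and> (\<forall>s\<ge>0. \<forall>t\<ge>0. d (f s) (f t) \<le> \<bar>s - t\<bar>)"

definition simple_pursuit_curve ::
  "'a set \<Rightarrow> ('a \<Rightarrow> 'a \<Rightarrow> real) \<Rightarrow> real \<Rightarrow> (real \<Rightarrow> 'a \<times> 'a) \<Rightarrow> bool"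
  where "simple_pursuit_curve K d \<epsilon> \<zeta> \<longleftrightarrow>
    (let L = (\<lambda>t. fst (\<zeta> t)); M = (\<lambda>t. snd (\<zeta> t)) in
      one_lipschitz_curve K d L \<and> one_lipschitz_curve K d M \<and>
      (\<forall>i::nat. d (L (real i * \<epsilon>)) (M (real i * \<epsilon>)) \<ge> \<epsilon> \<longrightarrow>
        d (L (real i * \<epsilon>)) (L (real (i + 1) * \<epsilon>)) = \<epsilon> \<and>
        lies_between d (L (real (i + 1) * \<epsilon>)) (L (real i * \<epsilon>)) (M (real i * \<epsilon>))))"

end

theory Submission
  imports Defs "HOL-Library.Diagonal_Subsequence"
begin

text \<open>
  Suppose that the pursuer \<open>L\<close> never gets closer than \<open>\<epsilon>\<close> to \<open>M\<close>. At the times \<open>i * \<epsilon>\<close> the gap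
  does not increase, since \<open>L\<close> gains \<open>\<epsilon>\<close> on the old position of \<open>M\<close> while \<open>M\<close> runs away by at
  most \<open>\<epsilon>\<close>; so the gap converges to some \<open>D \<ge> \<epsilon>\<close>. By compactness and a diagonal argument, the
  translates of the pursuit by \<open>i * \<epsilon>\<close> have a subsequence that converges at all multiples of
  \<open>\<epsilon> / 2\<close>. The limit is again a pursuit, and its gap is \<open>D\<close> at every step.

  A constant gap forces \<open>M\<close> to flee at full speed straight away from \<open>L\<close>. The betweenness
  property turns this into the fact that two consecutive steps take the limiting pursuer to
  distance \<open>2 * \<epsilon>\<close> (\<open>two_steps_of_constant_gap_pursuit\<close>), and, applied again, into
  the fact that \<open>n\<close> steps take it to distance \<open>n * \<epsilon>\<close> (\<open>distance_along_chain\<close>). This contradicts the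
  boundedness of a compact space.

  The case \<open>D = \<epsilon>\<close> is exceptional. There each step of \<open>L\<close> ends exactly where \<open>M\<close> has
  just been, the four points to be compared are no longer distinct, and the positions at multiples
  of \<open>\<epsilon>\<close> alone would allow \<open>L\<close> and \<open>M\<close> to swap two places for ever. The gap halfway through
  the step, which is at least \<open>\<epsilon>\<close> as well, excludes this: it leaves no shortcut from the
  second half of the step of \<open>L\<close> to the first half of the step of \<open>M\<close>, so that \<open>M\<close> continues
  straight where \<open>L\<close> arrives. This is why the limit is taken at half steps.
\<close>

section \<open>Limits in compact metric spaces\<close>

lemma (in Metric_space) tendsto_dist_of_limitin:
  assumes "limitin mtopology f x F" and "limitin mtopology g y F"
  shows "((\<lambda>i. d (f i) (g i)) \<longlongrightarrow> d x y) F"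
proof -
  have f: "x \<in> M" "\<forall>\<^sub>F i in F. f i \<in> M" "((\<lambda>i. d (f i) x) \<longlongrightarrow> 0) F"
    and g: "y \<in> M" "\<forall>\<^sub>F i in F. g i \<in> M" "((\<lambda>i. d (g i) y) \<longlongrightarrow> 0) F"
    using assms by (auto simp: limitin_metric_dist_null)
  have "((\<lambda>i. d (f i) x + d (g i) y) \<longlongrightarrow> 0) F"
    using tendsto_add[OF f(3) g(3)] by simp
  moreover have "\<forall>\<^sub>F i in F. norm (d (f i) (g i) - d x y) \<le> d (f i) x + d (g i) y"
    using f(2) g(2)
  proof eventually_elim
    case (elim i)
    have "d (f i) (g i) \<le> d (f i) x + d x y + d (g i) y"
      using triangle[of "f i" x "g i"] triangle[of x y "g i"] commute[of y "g i"] elim f(1) g(1)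
      by simp
    moreover have "d x y \<le> d (f i) x + d (f i) (g i) + d (g i) y"
      using triangle[of x "f i" y] triangle[of "f i" "g i" y] commute[of x "f i"] elim f(1) g(1)
      by simp
    ultimately show ?case by simp
  qed
  ultimately have "((\<lambda>i. d (f i) (g i) - d x y) \<longlongrightarrow> 0) F"
    by (rule Lim_null_comparison[rotated])
  then show ?thesis by (simp add: LIM_zero_iff)
qed

lemma (in Metric_space) compact_diagonal_subsequence:
  fixes \<sigma> :: "'i::countable \<Rightarrow> nat \<Rightarrow> 'a"
  assumes compact: "compact_space mtopology" and in_M: "\<And>k i. \<sigma> k i \<in> M"
  obtains r x where "strict_mono (r :: nat \<Rightarrow> nat)"
    and "\<And>k. limitin mtopology (\<lambda>i. \<sigma> k (r i)) (x k) sequentially"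
proof -
  define P where
    "P n s \<longleftrightarrow> (\<exists>l. limitin mtopology (\<lambda>i. \<sigma> (from_nat n) (s i)) l sequentially)" for n s
  interpret subseqs P
  proof
    fix n and s :: "nat \<Rightarrow> nat"
    have "range (\<lambda>i. \<sigma> (from_nat n) (s i)) \<subseteq> M" using in_M by blast
    then show "\<exists>r'. strict_mono r' \<and> P n (s \<circ> r')"
      using compact unfolding compact_space_sequentially P_def o_def by blast
  qed
  have "\<exists>l. limitin mtopology (\<lambda>i. \<sigma> k (diagseq i)) l sequentially" for k
  proof -
    let ?n = "to_nat k"
    have "P ?n (diagseq \<circ> (+) (Suc ?n))"
    proof (rule diagseq_holds)
      show "P n (s \<circ> r)" if "strict_mono r" "P n s" for r s :: "nat \<Rightarrow> nat" and n
        using that limitin_subsequence unfolding P_def o_def by fastforce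
    qed
    then obtain l where
      "limitin mtopology (\<lambda>i. \<sigma> k (diagseq (i + Suc ?n))) l sequentially"
      unfolding P_def o_def by (auto simp: add.commute)
    then show ?thesis
      using limitin_sequentially_offset_rev[of mtopology "\<lambda>i. \<sigma> k (diagseq i)" "Suc ?n" l]
      by blast
  qed
  then show ?thesis using that[OF subseq_diagseq] by metis
qed

section \<open>Consequences of betweenness\<close>

lemma (in Metric_space) betweennessD:
  assumes "betweenness_property M d" and "A \<in> M" "B \<in> M" "C \<in> M" "D \<in> M"
    and "A \<noteq> B" "B \<noteq> C" "C \<noteq> D" "A \<noteq> D"
    and "d A C = d A B + d B C" and "d B D = d B C + d C D"
  shows "d A D = d A B + d B D" and "d A D = d A C + d C D"
proof -
  have "d A B > 0" "d B C > 0" "d C D > 0" using assms by simp_all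
  then have "d A C > 0" "d B D > 0" using assms(10,11) by linarith+
  then have "A \<noteq> C" "B \<noteq> D" using assms(2,3) by auto
  then have "distinct [A, B, C, D]" using assms by auto
  then show "d A D = d A B + d B D" and "d A D = d A C + d C D"
    using assms unfolding betweenness_property_def lies_between_def by blast+
qed

text \<open>
  Two consecutive steps of a chain that add up propagate to the whole chain: \<open>x n\<close> lies between
  \<open>x 0\<close> and \<open>x (n + 1)\<close>, so betweenness puts \<open>x (n + 1)\<close> between \<open>x 0\<close> and \<open>x (n + 2)\<close>. The end
  points stay distinct because \<open>x 0\<close> is already too far from \<open>x (n + 1)\<close>.
\<close>

lemma (in Metric_space) distance_along_chain:
  assumes bet: "betweenness_property M d" and in_M: "\<And>n. x n \<in> M" and "e > 0"
    and one: "\<And>n. d (x n) (x (Suc n)) = e"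
    and two: "\<And>n. d (x n) (x (Suc (Suc n))) = 2 * e"
  shows "d (x 0) (x n) = real n * e"
proof -
  have "d (x 0) (x n) = real n * e \<and> d (x 0) (x (Suc n)) = real (Suc n) * e"
  proof (induction n)
    case 0
    show ?case using in_M one by simp
  next
    case (Suc n)
    show ?case
    proof (cases "n = 0")
      case True
      then show ?thesis using one two by simp
    next
      case False
      have "1 * e < real (Suc n) * e"
        using False \<open>e > 0\<close> by (intro mult_strict_right_mono) auto
      then have "d (x 0) (x (Suc n)) > e" using Suc by simp
      then have "x 0 \<noteq> x (Suc (Suc n))"
        using one[of "Suc n"] commute[of "x (Suc n)" "x (Suc (Suc n))"] by auto
      moreover have "x 0 \<noteq> x n" using False Suc \<open>e > 0\<close> in_M by fastforce
      moreover have "x n \<noteq> x (Suc n)" "x (Suc n) \<noteq> x (Suc (Suc n))"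
        using one[of n] one[of "Suc n"] \<open>e > 0\<close> in_M by fastforce+
      moreover have "d (x 0) (x (Suc n)) = d (x 0) (x n) + d (x n) (x (Suc n))"
        using Suc one[of n] by (simp add: algebra_simps)
      moreover have "d (x n) (x (Suc (Suc n)))
          = d (x n) (x (Suc n)) + d (x (Suc n)) (x (Suc (Suc n)))"
        using one two by simp
      ultimately have "d (x 0) (x (Suc (Suc n)))
          = d (x 0) (x (Suc n)) + d (x (Suc n)) (x (Suc (Suc n)))"
        using betweennessD(2)[OF bet in_M in_M in_M in_M] by blast
      then show ?thesis using Suc one[of "Suc n"] by (simp add: algebra_simps)
    qed
  qed
  then show ?thesis by blast
qed

text \<open>
  A pursuer goes from \<open>A\<close> to \<open>B\<close> towards \<open>E\<close> while the prey goes from \<open>E\<close> to \<open>F\<close>, and the gap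
  does not change. Then the triangle inequality through \<open>E\<close> is sharp, that is, \<open>E\<close> lies between
  \<open>B\<close> and \<open>F\<close>. A gap larger than \<open>e\<close> ensures that \<open>B \<noteq> E\<close> and \<open>A \<noteq> F\<close>, so that betweenness
  applies.
\<close>

lemma (in Metric_space) prey_flees_straight_large_gap:
  assumes bet: "betweenness_property M d" and in_M: "A \<in> M" "B \<in> M" "E \<in> M" "F \<in> M"
    and "e > 0" and AB: "d A B = e" and aim: "d A E = e + d B E" and EF: "d E F \<le> e"
    and gap: "d B F = d A E" and large: "d A E > e"
  shows "d A F = e + d A E"
proof -
  have sharp: "d B F = d B E + d E F" "d E F = e"
    using triangle[of B E F] in_M aim EF gap by linarith+
  have "A \<noteq> B" "B \<noteq> E" "E \<noteq> F" using AB aim large sharp \<open>e > 0\<close> in_M by fastforce+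
  moreover have "A \<noteq> F" using gap large AB commute[of A B] by auto
  ultimately have "d A F = d A B + d B F"
    using betweennessD(1)[OF bet in_M] aim AB sharp by auto
  then show ?thesis using AB gap by simp
qed

text \<open>
  If the gap is exactly \<open>e\<close>, then the pursuer steps from \<open>A\<close> to the position \<open>B\<close> of the prey,
  which goes on to \<open>F\<close>. Let \<open>U\<close> and \<open>V\<close> be the positions of the two in the middle of the step.
  Both are within \<open>e / 2\<close> of \<open>B\<close> but at distance at least \<open>e\<close>, so \<open>B\<close> is a midpoint of \<open>U\<close> and
  \<open>V\<close>. Hence betweenness applies to \<open>A, U, B, V\<close> and then to \<open>A, B, V, F\<close>.
\<close>

lemma (in Metric_space) prey_flees_straight_minimal_gap:
  assumes bet: "betweenness_property M d"
    and in_M: "A \<in> M" "U \<in> M" "B \<in> M" "V \<in> M" "F \<in> M" and "e > 0"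
    and AB: "d A B = e" and BF: "d B F = e"
    and half: "d A U \<le> e / 2" "d U B \<le> e / 2" "d B V \<le> e / 2" "d V F \<le> e / 2"
    and gap: "d U V \<ge> e"
  shows "d A F = 2 * e"
proof -
  have eqs: "d A U = e / 2" "d U B = e / 2" "d B V = e / 2" "d V F = e / 2" "d U V = e"
    using triangle[of A U B] triangle[of B V F] triangle[of U B V] in_M AB BF half gap
    by linarith+
  have neq: "A \<noteq> U" "U \<noteq> B" "B \<noteq> V" "V \<noteq> F" "A \<noteq> B"
    using eqs AB \<open>e > 0\<close> in_M by fastforce+
  have "A \<noteq> V" using eqs \<open>e > 0\<close> commute[of A U] by fastforce
  then have "d A V = d A B + d B V"
    using betweennessD(2)[OF bet in_M(1,2,3,4)] neq eqs AB by simp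
  moreover from this have "A \<noteq> F" using eqs AB \<open>e > 0\<close> commute[of V F] by fastforce
  ultimately have "d A F = d A B + d B F"
    using betweennessD(1)[OF bet in_M(1,3,4,5)] neq eqs BF by simp
  then show ?thesis using AB BF by simp
qed

section \<open>Pursuit with constant gap\<close>

text \<open>
  The sequences \<open>p\<close> and \<open>q\<close> give the positions of pursuer and prey at half steps. Since the prey
  flees straight, the distance from \<open>p 0\<close> to \<open>q 2\<close> is \<open>e + D\<close>; the next step of the pursuer ends
  at distance \<open>D - e\<close> from \<open>q 2\<close>, so it cannot end closer than \<open>2 * e\<close> to \<open>p 0\<close>.
\<close>

lemma (in Metric_space) two_steps_of_constant_gap_pursuit:
  fixes p q :: "nat \<Rightarrow> 'a"
  assumes bet: "betweenness_property M d" and in_M: "\<And>k. p k \<in> M" "\<And>k. q k \<in> M"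
    and "e > 0"
    and lip: "\<And>k. d (p k) (p (Suc k)) \<le> e / 2" "\<And>k. d (q k) (q (Suc k)) \<le> e / 2"
    and gap: "\<And>k. d (p k) (q k) \<ge> e"
    and const: "\<And>j. d (p (2 * j)) (q (2 * j)) = D"
    and step: "\<And>j. d (p (2 * j)) (p (2 * j + 2)) = e"
    and aim: "\<And>j. d (p (2 * j)) (q (2 * j)) = e + d (p (2 * j + 2)) (q (2 * j))"
  shows "d (p (2 * j)) (p (2 * j + 4)) = 2 * e"
proof -
  define k where "k = 2 * j"
  have gaps: "d (p k) (q k) = D" "d (p (k + 2)) (q (k + 2)) = D"
    using const[of j] const[of "j + 1"] by (simp_all add: k_def)
  have steps: "d (p k) (p (k + 2)) = e" "d (p (k + 2)) (p (k + 4)) = e"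
    using step[of j] step[of "j + 1"] by (simp_all add: k_def numeral_eq_Suc)
  have aims: "D = e + d (p (k + 2)) (q k)" "D = e + d (p (k + 4)) (q (k + 2))"
    using aim[of j] aim[of "j + 1"] const[of j] const[of "j + 1"]
    by (simp_all add: k_def numeral_eq_Suc)
  have p: "d (p k) (p (k + 1)) \<le> e / 2" "d (p (k + 1)) (p (k + 2)) \<le> e / 2"
    using lip(1)[of k] lip(1)[of "k + 1"] by simp_all
  have q: "d (q k) (q (k + 1)) \<le> e / 2" "d (q (k + 1)) (q (k + 2)) \<le> e / 2"
    using lip(2)[of k] lip(2)[of "k + 1"] by simp_all
  have q_step: "d (q k) (q (k + 2)) \<le> e"
    using triangle[of "q k" "q (k + 1)" "q (k + 2)"] in_M q by simp
  have "d (p k) (q (k + 2)) = e + D"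
  proof (cases "D > e")
    case True
    then show ?thesis
      using prey_flees_straight_large_gap[OF bet in_M(1,1,2,2) \<open>e > 0\<close> steps(1) _ q_step]
        gaps aims by simp
  next
    case False
    then have "D = e" using gap[of k] gaps by simp
    then have meet: "p (k + 2) = q k" using aims(1) in_M by simp
    then have "d (p k) (q (k + 2)) = 2 * e"
      using prey_flees_straight_minimal_gap
          [of "p k" "p (k + 1)" "p (k + 2)" "q (k + 1)" "q (k + 2)" e]
        bet in_M \<open>e > 0\<close> steps(1) gaps(2) p q gap[of "k + 1"] \<open>D = e\<close> by simp
    then show ?thesis using \<open>D = e\<close> by simp
  qed
  then have "d (p k) (p (k + 4)) \<ge> 2 * e"
    using triangle[of "p k" "p (k + 4)" "q (k + 2)"] in_M aims(2) by simp
  moreover have "d (p k) (p (k + 4)) \<le> 2 * e"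
    using triangle[of "p k" "p (k + 2)" "p (k + 4)"] in_M steps by simp
  ultimately show ?thesis by (simp add: k_def)
qed

lemma (in Metric_space) constant_gap_pursuit_unbounded:
  fixes p q :: "nat \<Rightarrow> 'a"
  assumes bet: "betweenness_property M d" and in_M: "\<And>k. p k \<in> M" "\<And>k. q k \<in> M"
    and "e > 0"
    and lip: "\<And>k. d (p k) (p (Suc k)) \<le> e / 2" "\<And>k. d (q k) (q (Suc k)) \<le> e / 2"
    and gap: "\<And>k. d (p k) (q k) \<ge> e"
    and const: "\<And>j. d (p (2 * j)) (q (2 * j)) = D"
    and step: "\<And>j. d (p (2 * j)) (p (2 * j + 2)) = e"
    and aim: "\<And>j. d (p (2 * j)) (q (2 * j)) = e + d (p (2 * j + 2)) (q (2 * j))"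
  shows "d (p 0) (p (2 * n)) = real n * e"
proof -
  have "d (p (2 * j)) (p (2 * Suc j)) = e" for j using step[of j] by simp
  moreover have "d (p (2 * j)) (p (2 * Suc (Suc j))) = 2 * e" for j
    using two_steps_of_constant_gap_pursuit[OF assms, of j] by (simp add: numeral_eq_Suc)
  ultimately show ?thesis
    using distance_along_chain[OF bet, of "\<lambda>j. p (2 * j)" e n] in_M \<open>e > 0\<close> by simp
qed

section \<open>Capture\<close>

theorem proposition1:
  fixes K :: "'a set" and d :: "'a \<Rightarrow> 'a \<Rightarrow> real" and \<epsilon> :: real
    and L M :: "real \<Rightarrow> 'a"
  assumes "geodesic_space K d"
    and "compact_space (Metric_space.mtopology K d)"
    and "betweenness_property K d"
    and "\<epsilon> > 0"
    and "simple_pursuit_curve K d \<epsilon> (\<lambda>t. (L t, M t))"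
  shows "\<exists>T>0. d (L T) (M T) < \<epsilon>"
proof (rule ccontr)
  assume "\<not> (\<exists>T>0. d (L T) (M T) < \<epsilon>)"
  then have far: "d (L t) (M t) \<ge> \<epsilon>" if "t > 0" for t using that by force
  interpret Metric_space K d using assms(1) by (simp add: geodesic_space_def)
  have in_K: "L t \<in> K" "M t \<in> K" if "t \<ge> 0" for t
    using assms(5) that by (auto simp: simple_pursuit_curve_def one_lipschitz_curve_def)
  have lip: "d (L s) (L t) \<le> \<bar>s - t\<bar>" "d (M s) (M t) \<le> \<bar>s - t\<bar>" if "s \<ge> 0" "t \<ge> 0" for s t
    using assms(5) that by (auto simp: simple_pursuit_curve_def one_lipschitz_curve_def)

  \<comment> \<open>The bound \<open>far\<close> concerns positive times only, so the steps are counted from time \<open>\<epsilon>\<close>.\<close>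
  define \<tau> where "\<tau> k i = real (Suc i) * \<epsilon> + real k * (\<epsilon> / 2)" for k i :: nat
  have \<tau>_pos: "\<tau> k i > 0" for k i
    unfolding \<tau>_def using \<open>\<epsilon> > 0\<close> by (intro add_pos_nonneg mult_pos_pos) auto
  have \<tau>_even: "\<tau> (2 * j) i = real (Suc (i + j)) * \<epsilon>" for j i
    by (simp add: \<tau>_def field_simps)
  have pursuit: "d (L (\<tau> (2 * j) i)) (L (\<tau> (2 * j + 2) i)) = \<epsilon>"
    "d (L (\<tau> (2 * j) i)) (M (\<tau> (2 * j) i)) = \<epsilon> + d (L (\<tau> (2 * j + 2) i)) (M (\<tau> (2 * j) i))"
    for j i
  proof -
    have next_step: "\<tau> (2 * j + 2) i = real (Suc (i + j) + 1) * \<epsilon>"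
      using \<tau>_even[of "Suc j" i] by simp
    have "d (L (real (Suc (i + j)) * \<epsilon>)) (M (real (Suc (i + j)) * \<epsilon>)) \<ge> \<epsilon>"
      using far[OF \<tau>_pos[of "2 * j" i]] unfolding \<tau>_even .
    then have *: "d (L (real (Suc (i + j)) * \<epsilon>)) (L (real (Suc (i + j) + 1) * \<epsilon>)) = \<epsilon> \<and>
        lies_between d (L (real (Suc (i + j) + 1) * \<epsilon>)) (L (real (Suc (i + j)) * \<epsilon>))
          (M (real (Suc (i + j)) * \<epsilon>))"
      using assms(5) unfolding simple_pursuit_curve_def Let_def fst_conv snd_conv by blast
    then show "d (L (\<tau> (2 * j) i)) (L (\<tau> (2 * j + 2) i)) = \<epsilon>"
      "d (L (\<tau> (2 * j) i)) (M (\<tau> (2 * j) i))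
        = \<epsilon> + d (L (\<tau> (2 * j + 2) i)) (M (\<tau> (2 * j) i))"
      unfolding \<tau>_even next_step lies_between_def by simp_all
  qed

  define gap where "gap i = d (L (\<tau> 0 i)) (M (\<tau> 0 i))" for i
  have "decseq gap"
  proof (rule decseq_SucI)
    fix i
    have Suc: "\<tau> 0 (Suc i) = \<tau> 2 i" "\<tau> 2 i - \<tau> 0 i = \<epsilon>"
      by (simp_all add: \<tau>_def field_simps)
    have "d (L (\<tau> 2 i)) (M (\<tau> 2 i)) \<le> d (L (\<tau> 2 i)) (M (\<tau> 0 i)) + d (M (\<tau> 0 i)) (M (\<tau> 2 i))"
      using in_K less_imp_le[OF \<tau>_pos] by (intro triangle) auto
    also have "d (M (\<tau> 0 i)) (M (\<tau> 2 i)) \<le> \<epsilon>"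
      using lip(2)[of "\<tau> 0 i" "\<tau> 2 i"] less_imp_le[OF \<tau>_pos] Suc(2) \<open>\<epsilon> > 0\<close> by simp
    finally show "gap (Suc i) \<le> gap i" using pursuit(2)[of 0 i] Suc(1) by (simp add: gap_def numeral_2_eq_2)
  qed
  then obtain D where D: "gap \<longlonglongrightarrow> D"
    using decseq_convergent[of gap 0] by (auto simp: gap_def)

  \<comment> \<open>The index of the diagonal argument consists of a half step and a choice of player.\<close>
  define \<sigma> where "\<sigma> = (\<lambda>(k, pursuer) i. if pursuer then L (\<tau> k i) else M (\<tau> k i))"
  have "\<sigma> a i \<in> K" for a i
    using in_K less_imp_le[OF \<tau>_pos] by (auto simp: \<sigma>_def split: prod.splits)
  then obtain r x where r: "strict_mono (r :: nat \<Rightarrow> nat)"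
    and x: "\<And>a. limitin mtopology (\<lambda>i. \<sigma> a (r i)) (x a) sequentially"
    using compact_diagonal_subsequence[OF assms(2), of \<sigma>] by blast
  define p q where "p k = x (k, True)" and "q k = x (k, False)" for k
  have p: "limitin mtopology (\<lambda>i. L (\<tau> k (r i))) (p k) sequentially"
    and q: "limitin mtopology (\<lambda>i. M (\<tau> k (r i))) (q k) sequentially" for k
    using x[of "(k, True)"] x[of "(k, False)"] by (simp_all add: \<sigma>_def p_def q_def)
  note lim = tendsto_dist_of_limitin
  have p_in_K: "p k \<in> K" for k using limitin_mspace[OF p] .
  have q_in_K: "q k \<in> K" for k using limitin_mspace[OF q] .

  have "d (p 0) (p (2 * n)) = real n * \<epsilon>" for n
  proof (rule constant_gap_pursuit_unbounded[OF assms(3) p_in_K q_in_K \<open>\<epsilon> > 0\<close>])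
    have "\<bar>\<tau> k i - \<tau> (Suc k) i\<bar> = \<epsilon> / 2" for k i
      using \<open>\<epsilon> > 0\<close> by (simp add: \<tau>_def field_simps)
    then have half: "d (L (\<tau> k i)) (L (\<tau> (Suc k) i)) \<le> \<epsilon> / 2"
      "d (M (\<tau> k i)) (M (\<tau> (Suc k) i)) \<le> \<epsilon> / 2" for k i
      using lip[OF less_imp_le[OF \<tau>_pos] less_imp_le[OF \<tau>_pos], of k i "Suc k" i] by metis+
    show "d (p k) (p (Suc k)) \<le> \<epsilon> / 2" for k
      using half(1) by (intro LIMSEQ_le_const2[OF lim[OF p p]]) blast
    show "d (q k) (q (Suc k)) \<le> \<epsilon> / 2" for k
      using half(2) by (intro LIMSEQ_le_const2[OF lim[OF q q]]) blast
    show "d (p k) (q k) \<ge> \<epsilon>" for k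
      using far[OF \<tau>_pos] by (auto intro!: LIMSEQ_le_const[OF lim[OF p q]])
    show "d (p (2 * j)) (q (2 * j)) = D" for j
    proof -
      have "(\<lambda>i. gap (r i + j)) \<longlonglongrightarrow> D"
        using LIMSEQ_subseq_LIMSEQ[OF LIMSEQ_ignore_initial_segment[OF D, of j] r]
        by (simp add: o_def)
      then have "(\<lambda>i. d (L (\<tau> (2 * j) (r i))) (M (\<tau> (2 * j) (r i)))) \<longlonglongrightarrow> D"
        using \<tau>_even[of 0] by (simp add: gap_def \<tau>_even)
      then show ?thesis using LIMSEQ_unique lim[OF p q] by blast
    qed
    show "d (p (2 * j)) (p (2 * j + 2)) = \<epsilon>" for j
      using lim[OF p p, of "2 * j" "2 * j + 2"] unfolding pursuit(1)
      by (simp add: LIMSEQ_const_iff)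
    show "d (p (2 * j)) (q (2 * j)) = \<epsilon> + d (p (2 * j + 2)) (q (2 * j))" for j
      using lim[OF p q, of "2 * j" "2 * j"]
        tendsto_add[OF tendsto_const lim[OF p q, of "2 * j + 2" "2 * j"], of \<epsilon>]
      unfolding pursuit(2) by (rule LIMSEQ_unique)
  qed
  moreover obtain B where "\<And>y z. y \<in> K \<Longrightarrow> z \<in> K \<Longrightarrow> d y z \<le> B"
    using compactin_imp_mbounded[of K] assms(2) unfolding mbounded_alt
    by (auto simp: compact_space_def)
  ultimately have "real n * \<epsilon> \<le> B" for n using p_in_K by metis
  moreover obtain n where "B < real n * \<epsilon>" using reals_Archimedean3[OF \<open>\<epsilon> > 0\<close>] by blast
  ultimately show False by (meson not_le)
qed

end
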